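(* Consider the sparse linear Gaussian model: $S\in\{1,\dots,N\}$, $\mathcal{X}_S=\{\mathbf{x}\in\mathbb{R}^N:\|\mathbf{x}\|_0\le S\}$, $\mathbf{H}\in\mathbb{R}^{M\times N}$ with $\operatorname{spark}(\mathbf{H})>S$, $\sigma>0$, and observation $\mathbf{y}=\mathbf{H}\mathbf{x}+\mathbf{n}$ with $\mathbf{n}\sim\mathcal{N}(\mathbf{0},\sigma^2\mathbf{I})$, $\mathbf{x}\in\mathcal{X}_S$. Let $g:\mathcal{X}_S\to\mathbb{R}$ be a parameter function and $\mathbf{x}_0\in\mathcal{X}_S$. Let $D=\operatorname{rank}(\mathbf{H})$, let $\mathbf{H}=\mathbf{U}\mathbf{\Sigma}\mathbf{V}^T$ be a thin SVD ($\mathbf{U}\in\mathbb{R}^{M\times D}$, $\mathbf{V}\in\mathbb{R}^{N\times D}$ with orthonormal columns, $\mathbf{\Sigma}\in\mathbb{R}^{D\times D}$ diagonal with positive diagonal) and $\widetilde{\mathbf{H}}=\mathbf{V}\mathbf{\Sigma}^{-1}$. Then a bias function $c:\mathcal{X}_S\to\mathbb{R}$ is valid at $\mathbf{x}_0$ if and only if there exists a sequence $a\in\ell^2(\mathbb{Z}_+^D)$ such that for all $\mathbf{x}\in\mathcal{X}_S$ $$c(\mathbf{x})=\exp\Big(\tfrac{1}{2\sigma^2}\|\mathbf{H}\mathbf{x}_0\|_2^2-\tfrac{1}{\sigma^2}\mathbf{x}^T\mathbf{H}^T\mathbf{H}\mathbf{x}_0\Big)\sum_{\mathbf{p}\in\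mathbb{Z}_+^D}\frac{a[\mathbf{p}]}{\sqrt{\mathbf{p}!}}\Big(\tfrac{1}{\sigma}\widetilde{\mathbf{H}}^{\dagger}\mathbf{x}\Big)^{\mathbf{p}}-g(\mathbf{x}).$$
   Context: $\|\mathbf{x}\|_0$ = number of nonzero entries; $\operatorname{spark}$ = minimum number of linearly dependent columns; $\dagger$ denotes Moore–Penrose pseudoinverse. For a multi-index $\mathbf{p}\in\mathbb{Z}_+^D$: $\mathbf{p}!=\prod_l p_l!$, $\mathbf{z}^{\mathbf{p}}=\prod_l z_l^{p_l}$. An estimator is a function $\hat g:\mathbb{R}^M\to\mathbb{R}$; its bias is $b(\hat g;\mathbf{x})=\mathsf{E}_{\mathbf{x}}\{\hat g(\mathbf{y})\}-g(\mathbf{x})$ and variance $v(\hat g;\mathbf{x})=\mathsf{E}_{\mathbf{x}}\{(\hat g(\mathbf{y})-\mathsf{E}_{\mathbf{x}}\{\hat g(\mathbf{y})\})^2\}$, where $\mathsf{E}_{\mathbf{x}}$ is expectation under the density of $\mathbf{y}$ for parameter $\mathbf{x}$. A bias function $c$ is valid at $\mathbf{x}_0$ if there exists an estimator $\hat g$ with $v(\hat g;\mathbf{x}_0)<\infty$ and $b(\hat g;\mathbf{x})=c(\mathbf{x})$ for all $\mathbf{x}\in\mathcal{X}_S$. *)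

theory Defs
  imports "HOL-Analysis.Analysis"
begin

definition l0norm :: "real^'n \<Rightarrow> nat" where
  "l0norm x = card {i. x $ i \<noteq> 0}"

definition sparse_set :: "nat \<Rightarrow> (real^'n) set" where
  "sparse_set S = {x. l0norm x \<le> S}"

text \<open>spark: minimum number of linearly dependent columns (infinity if none).\<close>
definition spark :: "real^'n^'m \<Rightarrow> enat" where
  "spark H = Inf {enat (card J) | J. \<exists>c :: 'n \<Rightarrow> real.
      (\<exists>j\<in>J. c j \<noteq> 0) \<and> (\<Sum>j\<in>J. c j *\<^sub>R column j H) = 0}"

definition pinv :: "real^'n^'m \<Rightarrow> real^'m^'n" where
  "pinv A = (THE B. A ** B ** A = A \<and> B ** A ** B = B \<and>
                    transpose (A ** B) = A ** B \<and> transpose (B ** A) = B ** A)"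

definition gauss_density :: "real \<Rightarrow> real^'m \<Rightarrow> real^'m \<Rightarrow> real" where
  "gauss_density \<sigma> \<mu> y =
     (2 * pi * \<sigma>\<^sup>2) powr (- real CARD('m) / 2) * exp (- (norm (y - \<mu>))\<^sup>2 / (2 * \<sigma>\<^sup>2))"

definition obs_measure :: "real^'n^'m \<Rightarrow> real \<Rightarrow> real^'n \<Rightarrow> (real^'m) measure" where
  "obs_measure H \<sigma> x = density lborel (\<lambda>y. ennreal (gauss_density \<sigma> (H *v x) y))"

definition expect :: "real^'n^'m \<Rightarrow> real \<Rightarrow> real^'n \<Rightarrow> (real^'m \<Rightarrow> real) \<Rightarrow> real" where
  "expect H \<sigma> x gh = (\<integral>y. gh y \<partial>obs_measure H \<sigma> x)"

definition bias :: "real^'n^'m \<Rightarrow> real \<Rightarrow> (real^'n \<Rightarrow> real) \<Rightarrow> (real^'m \<Rightarrow> real) \<Rightarrow> real^'n \<Rightarrow> real" where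
  "bias H \<sigma> g gh x = expect H \<sigma> x gh - g x"

definition variance_at :: "real^'n^'m \<Rightarrow> real \<Rightarrow> (real^'m \<Rightarrow> real) \<Rightarrow> real^'n \<Rightarrow> ennreal" where
  "variance_at H \<sigma> gh x = (\<integral>\<^sup>+ y. ennreal ((gh y - expect H \<sigma> x gh)\<^sup>2) \<partial>obs_measure H \<sigma> x)"

definition valid_bias :: "real^'n^'m \<Rightarrow> real \<Rightarrow> nat \<Rightarrow> (real^'n \<Rightarrow> real) \<Rightarrow> (real^'n \<Rightarrow> real) \<Rightarrow> real^'n \<Rightarrow> bool" where
  "valid_bias H \<sigma> S g c x0 \<longleftrightarrow>
     (\<exists>gh :: real^'m \<Rightarrow> real.
        integrable (obs_measure H \<sigma> x0) gh \<and> variance_at H \<sigma> gh x0 < \<infinity> \<and>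
        (\<forall>x\<in>sparse_set S. integrable (obs_measure H \<sigma> x) gh \<and> bias H \<sigma> g gh x = c x))"

text \<open>Multi-index notation on Z_+^D, D indexed by the finite type 'd.\<close>
definition mfact :: "('d::finite \<Rightarrow> nat) \<Rightarrow> real" where
  "mfact p = (\<Prod>l\<in>UNIV. fact (p l))"

definition mpow :: "real^'d \<Rightarrow> ('d::finite \<Rightarrow> nat) \<Rightarrow> real" where
  "mpow z p = (\<Prod>l\<in>UNIV. (z $ l) ^ p l)"

definition ell2 :: "(('d::finite \<Rightarrow> nat) \<Rightarrow> real) \<Rightarrow> bool" where
  "ell2 a \<longleftrightarrow> (\<lambda>p. (a p)\<^sup>2) summable_on UNIV"

end

theory Submission
  imports Defs "HOL-Probability.Distributions"
begin

text \<open>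
  Put \<open>z(x) = \<Sigma> V\<^sup>T x / \<sigma>\<close>, so that \<open>H x = \<sigma> U z(x)\<close>. In \<open>L\<^sup>2\<close> of the distribution at \<open>x0\<close>, the likelihood
  ratios of \<open>x\<close> against \<open>x0\<close>, divided by the exponential prefactor of the theorem, have Gram
  kernel \<open>exp (z(x) \<bullet> z(x'))\<close>. The sequences \<open>z(x)\<^sup>p / sqrt (p!)\<close> in \<open>\<ell>\<^sup>2\<close> have the same kernel.
  Two families with equal Gram kernels represent the same functions
  \<open>x \<mapsto> \<langle>G, k x\<rangle>\<close>: a sequence of linear combinations approaching the projection of \<open>G\<close> onto the
  span of one family is carried isometrically to a Cauchy sequence in the span of the other.
\<close>

subsection \<open>Square-integrable functions\<close>

text \<open>A predicate on functions rather than a space of classes: estimators on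
  \<open>obs_measure\<close> and coefficient sequences on \<open>count_space UNIV\<close> are then
  handled by the same lemmas.\<close>

definition L2 :: "'a measure \<Rightarrow> ('a \<Rightarrow> real) \<Rightarrow> bool" where
  "L2 M f \<longleftrightarrow> f \<in> borel_measurable M \<and> integrable M (\<lambda>x. (f x)\<^sup>2)"

lemma L2_measurable: "L2 M f \<Longrightarrow> f \<in> borel_measurable M"
  and L2_integrable_square: "L2 M f \<Longrightarrow> integrable M (\<lambda>x. (f x)\<^sup>2)"
  by (auto simp: L2_def)

lemma L2_integrable_mult:
  assumes "L2 M f" "L2 M g"
  shows "integrable M (\<lambda>x. f x * g x)"
proof (rule Bochner_Integration.integrable_bound)
  show "integrable M (\<lambda>x. (f x)\<^sup>2 + (g x)\<^sup>2)"
    using assms by (auto simp: L2_def)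
  show "(\<lambda>x. f x * g x) \<in> borel_measurable M"
    using assms by (auto simp: L2_def)
  have "norm (a * b) \<le> norm (a\<^sup>2 + b\<^sup>2)" for a b :: real
  proof -
    have "2 * (\<bar>a\<bar> * \<bar>b\<bar>) \<le> a\<^sup>2 + b\<^sup>2"
      using sum_squares_bound[of "\<bar>a\<bar>" "\<bar>b\<bar>"] by (simp add: mult.assoc)
    moreover have "0 \<le> \<bar>a\<bar> * \<bar>b\<bar>" by simp
    ultimately have "\<bar>a\<bar> * \<bar>b\<bar> \<le> a\<^sup>2 + b\<^sup>2" by linarith
    then show ?thesis by (simp add: abs_mult)
  qed
  then show "AE x in M. norm (f x * g x) \<le> norm ((f x)\<^sup>2 + (g x)\<^sup>2)"
    by blast
qed

lemma L2_lincomb: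
  assumes "L2 M f" "L2 M g"
  shows "L2 M (\<lambda>x. a * f x + b * g x)"
proof -
  have "integrable M (\<lambda>x. a\<^sup>2 * (f x)\<^sup>2 + 2 * a * b * (f x * g x) + b\<^sup>2 * (g x)\<^sup>2)"
    using assms L2_integrable_mult[OF assms] by (auto simp: L2_def)
  then have "integrable M (\<lambda>x. (a * f x + b * g x)\<^sup>2)"
    by (simp add: power2_eq_square algebra_simps)
  then show ?thesis
    using assms by (auto simp: L2_def)
qed

lemma L2_diff: "L2 M f \<Longrightarrow> L2 M g \<Longrightarrow> L2 M (\<lambda>x. f x - g x)"
  using L2_lincomb[of M f g 1 "-1"] by simp

lemma L2_integral_square_lincomb:
  assumes "L2 M f" "L2 M g"
  shows "(\<integral>x. (a * f x + b * g x)\<^sup>2 \<partial>M)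
       = a\<^sup>2 * (\<integral>x. (f x)\<^sup>2 \<partial>M) + 2 * a * b * (\<integral>x. f x * g x \<partial>M) + b\<^sup>2 * (\<integral>x. (g x)\<^sup>2 \<partial>M)"
proof -
  have "(\<integral>x. (a * f x + b * g x)\<^sup>2 \<partial>M)
      = (\<integral>x. a\<^sup>2 * (f x)\<^sup>2 + 2 * a * b * (f x * g x) + b\<^sup>2 * (g x)\<^sup>2 \<partial>M)"
    by (simp add: power2_eq_square algebra_simps)
  also have "\<dots> = a\<^sup>2 * (\<integral>x. (f x)\<^sup>2 \<partial>M) + 2 * a * b * (\<integral>x. f x * g x \<partial>M) + b\<^sup>2 * (\<integral>x. (g x)\<^sup>2 \<partial>M)"
    using assms L2_integrable_mult[OF assms] by (simp add: L2_def)
  finally show ?thesis .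
qed

lemma L2_integral_lincomb_mult:
  assumes "L2 M f" "L2 M g" "L2 M h"
  shows "(\<integral>x. (a * f x + b * g x) * h x \<partial>M) = a * (\<integral>x. f x * h x \<partial>M) + b * (\<integral>x. g x * h x \<partial>M)"
  using L2_integrable_mult[OF assms(1,3)] L2_integrable_mult[OF assms(2,3)]
  by (simp add: algebra_simps)

text \<open>A form of Cauchy-Schwarz without square roots: the integral of (f + s g)^2 is
  nonnegative at s = t and s = -t, and dividing by t bounds the absolute value. The free weight t is
  later matched to the rate of convergence.\<close>

lemma L2_abs_integral_mult_le:
  assumes "L2 M f" "L2 M g" "0 < t"
  shows "2 * \<bar>\<integral>x. f x * g x \<partial>M\<bar> \<le> (\<integral>x. (f x)\<^sup>2 \<partial>M) / t + t * (\<integral>x. (g x)\<^sup>2 \<partial>M)"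
proof -
  have *: "0 \<le> (\<integral>x. (f x)\<^sup>2 \<partial>M) + 2 * s * (\<integral>x. f x * g x \<partial>M) + s\<^sup>2 * (\<integral>x. (g x)\<^sup>2 \<partial>M)" for s
  proof -
    have "0 \<le> (\<integral>x. (1 * f x + s * g x)\<^sup>2 \<partial>M)" by simp
    then show ?thesis
      unfolding L2_integral_square_lincomb[OF assms(1,2)] by simp
  qed
  have "t * (2 * \<bar>\<integral>x. f x * g x \<partial>M\<bar>) \<le> t * ((\<integral>x. (f x)\<^sup>2 \<partial>M) / t + t * (\<integral>x. (g x)\<^sup>2 \<partial>M))"
    using *[of t] *[of "-t"] \<open>0 < t\<close> by (simp add: algebra_simps power2_eq_square abs_if)
  then show ?thesis
    using \<open>0 < t\<close> by simp
qed

text \<open>Riesz-Fischer for a sequence with a prescribed Cauchy rate. The weighted squared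
  increments have a finite total integral, so the sequence converges almost everywhere; Fatou's
  lemma then passes the rate on to the limit.\<close>

lemma L2_complete_geometric:
  assumes f: "\<And>n. L2 M (f n)"
    and cauchy: "\<And>k j. k \<le> j \<Longrightarrow> (\<integral>x. (f j x - f k x)\<^sup>2 \<partial>M) \<le> (1/4)^k"
  obtains F where "L2 M F" "\<And>k. (\<integral>x. (F x - f k x)\<^sup>2 \<partial>M) \<le> (1/4)^k"
proof -
  note [measurable] = L2_measurable[OF f]
  have diff: "integrable M (\<lambda>x. (f j x - f k x)\<^sup>2)" for j k
    using L2_integrable_square[OF L2_diff[OF f f]] .
  have nn: "(\<integral>\<^sup>+x. ennreal ((f j x - f k x)\<^sup>2) \<partial>M) \<le> ennreal ((1/4)^k)" if "k \<le> j" for j k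
    using cauchy[OF that] diff[of j k] by (subst nn_integral_eq_integral) (auto intro: ennreal_leI)
  \<comment> \<open>The weight 2^k is mild enough that the integrals of \<open>d k\<close> are at
    most (1/4)^k * 2^k = (1/2)^k and hence summable, yet large enough that (1/2)^k +
    \<open>d k x\<close> dominates the unsquared increment.\<close>
  define d where "d k x = 2^k * (f (Suc k) x - f k x)\<^sup>2" for k x
  have [measurable]: "d k \<in> borel_measurable M" for k
    unfolding d_def by measurable
  have "(\<integral>\<^sup>+x. (\<Sum>k. ennreal (d k x)) \<partial>M) = (\<Sum>k. \<integral>\<^sup>+x. ennreal (d k x) \<partial>M)"
    by (rule nn_integral_suminf) measurable
  also have "\<dots> \<le> (\<Sum>k. ennreal ((1/2)^k))"
  proof (intro suminf_le)
    fix k :: nat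
    have "(\<integral>\<^sup>+x. ennreal (d k x) \<partial>M) = 2^k * (\<integral>\<^sup>+x. ennreal ((f (Suc k) x - f k x)\<^sup>2) \<partial>M)"
      by (simp add: d_def ennreal_mult' ennreal_power[symmetric] nn_integral_cmult)
    also have "\<dots> \<le> 2^k * ennreal ((1/4)^k)"
      by (intro mult_left_mono nn) auto
    also have "\<dots> = ennreal (2^k * (1/4)^k)"
      by (simp add: ennreal_mult' ennreal_power[symmetric])
    also have "(2::real)^k * (1/4)^k = (1/2)^k"
      by (simp add: power_mult_distrib[symmetric])
    finally show "(\<integral>\<^sup>+x. ennreal (d k x) \<partial>M) \<le> ennreal ((1/2)^k)" .
  qed auto
  also have "\<dots> < \<infinity>"
    by (simp add: suminf_ennreal2 summable_geometric)
  finally have "AE x in M. (\<Sum>k. ennreal (d k x)) \<noteq> \<infinity>"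
    by (intro nn_integral_noteq_infinite) auto
  then have conv: "AE x in M. (\<lambda>n. f n x) \<longlonglongrightarrow> lim (\<lambda>n. f n x)"
  proof eventually_elim
    case (elim x)
    then have "summable (\<lambda>k. d k x)"
      by (intro summable_suminf_not_top) (auto simp: d_def)
    then have sum: "summable (\<lambda>k. (1/2)^k + d k x)"
      by (intro summable_add summable_geometric) auto
    have "\<bar>f (Suc k) x - f k x\<bar> \<le> (1/2)^k + d k x" for k
    proof -
      define u t where "u = \<bar>f (Suc k) x - f k x\<bar>" and "t = (2::real)^k"
      have "0 < t" "0 \<le> u" by (simp_all add: t_def u_def)
      \<comment> \<open>The arithmetic-geometric mean inequality 2 u <= 1/t + t u^2, obtained from a
        square, trades the increment for its weighted square.\<close>
      have "0 \<le> (1 - t * u)\<^sup>2 / t"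
        using \<open>0 < t\<close> by simp
      also have "\<dots> = 1 / t - 2 * u + t * u\<^sup>2"
        using \<open>0 < t\<close> by (simp add: power2_eq_square field_simps)
      finally have "u \<le> 1 / t + t * u\<^sup>2"
        using \<open>0 \<le> u\<close> by simp
      then show ?thesis by (simp add: d_def u_def t_def power_one_over)
    qed
    then have "summable (\<lambda>k. f (Suc k) x - f k x)"
      by (intro summable_comparison_test'[OF sum, of 0]) auto
    then have "convergent (\<lambda>n. (\<Sum>k<n. f (Suc k) x - f k x) + f 0 x)"
      by (intro convergent_add convergent_const) (simp add: summable_iff_convergent)
    then show ?case
      using sum_lessThan_telescope[of "\<lambda>n. f n x"] by (simp add: convergent_LIMSEQ_iff)
  qed
  \<comment> \<open>Where the sequence diverges \<open>lim\<close> has an unspecified value; by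
    \<open>conv\<close> this concerns a null set only.\<close>
  define F where "F x = lim (\<lambda>n. f n x)" for x
  have [measurable]: "F \<in> borel_measurable M"
    unfolding F_def by measurable
  have le: "(\<integral>\<^sup>+x. ennreal ((F x - f k x)\<^sup>2) \<partial>M) \<le> ennreal ((1/4)^k)" for k
  proof -
    have "(\<integral>\<^sup>+x. ennreal ((F x - f k x)\<^sup>2) \<partial>M)
        = (\<integral>\<^sup>+x. liminf (\<lambda>j. ennreal ((f j x - f k x)\<^sup>2)) \<partial>M)"
    proof (rule nn_integral_cong_AE)
      show "AE x in M. ennreal ((F x - f k x)\<^sup>2) = liminf (\<lambda>j. ennreal ((f j x - f k x)\<^sup>2))"
        using conv
      proof eventually_elim
        case (elim x)
        then have "(\<lambda>j. ennreal ((f j x - f k x)\<^sup>2)) \<longlonglongrightarrow> ennreal ((F x - f k x)\<^sup>2)"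
          unfolding F_def by (intro tendsto_intros)
        then show ?case
          by (intro lim_imp_Liminf[symmetric]) auto
      qed
    qed
    also have "\<dots> \<le> liminf (\<lambda>j. \<integral>\<^sup>+x. ennreal ((f j x - f k x)\<^sup>2) \<partial>M)"
      by (rule nn_integral_liminf) measurable
    also have "\<dots> \<le> liminf (\<lambda>j. ennreal ((1/4)^k))"
      by (intro Liminf_mono eventually_sequentiallyI[of k] nn)
    also have "\<dots> = ennreal ((1/4)^k)"
      by (simp add: Liminf_const)
    finally show ?thesis .
  qed
  have int: "integrable M (\<lambda>x. (F x - f k x)\<^sup>2)" for k
    using le[of k] by (intro integrableI_bounded) (auto simp: order.strict_trans1)
  show thesis
  proof
    have "L2 M (\<lambda>x. F x - f 0 x)"
      using int[of 0] by (simp add: L2_def)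
    from L2_lincomb[OF this f[of 0], of 1 1] show "L2 M F" by simp
    show "(\<integral>x. (F x - f k x)\<^sup>2 \<partial>M) \<le> (1/4)^k" for k
      using le[of k] int[of k] by (simp add: nn_integral_eq_integral)
  qed
qed

subsection \<open>Families with equal Gram kernels\<close>

text \<open>The graph of the linear extension of \<open>k i\<close> \<mapsto> \<open>l i\<close>. A
  relation requires no proof that different representations of one linear combination have the same
  image, and binary combinations suit induction.\<close>

inductive paired_span :: "('i \<Rightarrow> 'a \<Rightarrow> real) \<Rightarrow> ('i \<Rightarrow> 'b \<Rightarrow> real) \<Rightarrow> ('a \<Rightarrow> real) \<Rightarrow> ('b \<Rightarrow> real) \<Rightarrow> bool"
  for k l where
  base: "paired_span k l (k i) (l i)"
| lincomb: "paired_span k l f f' \<Longrightarrow> paired_span k l h h' \<Longrightarrow>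
    paired_span k l (\<lambda>x. a * f x + b * h x) (\<lambda>y. a * f' y + b * h' y)"

lemma paired_span_L2:
  assumes "paired_span k l f f'" "\<And>i. L2 M (k i)" "\<And>i. L2 N (l i)"
  shows "L2 M f" "L2 N f'"
  using assms(1) by (induction; use assms(2,3) L2_lincomb in blast)+

text \<open>The correspondence is isometric: both sides are bilinear and agree on generators. The
  outer induction reduces \<open>f\<close> to a generator, the inner one does the same for
  \<open>h\<close>.\<close>

lemma paired_span_gram:
  assumes k: "\<And>i. L2 M (k i)" and l: "\<And>i. L2 N (l i)"
    and gram: "\<And>i j. (\<integral>x. k i x * k j x \<partial>M) = (\<integral>y. l i y * l j y \<partial>N)"
    and f: "paired_span k l f f'" and h: "paired_span k l h h'"
  shows "(\<integral>x. f x * h x \<partial>M) = (\<integral>y. f' y * h' y \<partial>N)"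
proof -
  have L2s: "L2 M u" "L2 N u'" if "paired_span k l u u'" for u u'
    using paired_span_L2[OF that] k l by blast+
  show ?thesis
    using f
  proof induction
    case (base i)
    from h show ?case
    proof induction
      case (base j)
      show ?case by (rule gram)
    next
      case (lincomb f f' h h' a b)
      then show ?case
        using L2_integral_lincomb_mult[of M f h "k i" a b] L2_integral_lincomb_mult[of N f' h' "l i" a b]
          L2s k l by (simp add: mult.commute[of "k i _"] mult.commute[of "l i _"])
    qed
  next
    case (lincomb f f' g g' a b)
    then show ?case
      using L2_integral_lincomb_mult[of M f g h a b] L2_integral_lincomb_mult[of N f' g' h' a b]
        L2s h by simp
  qed
qed

text \<open>No projection of \<open>G\<close> is constructed in the span of \<open>k\<close>: a
  minimising sequence for the distance to \<open>G\<close> suffices, since its image converges. The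
  hypotheses on the two families are symmetric, so one statement serves both directions of the final
  equivalence.\<close>

theorem equal_gram_transfer:
  fixes k :: "'i \<Rightarrow> 'a \<Rightarrow> real" and l :: "'i \<Rightarrow> 'b \<Rightarrow> real"
  assumes k: "\<And>i. L2 M (k i)" and l: "\<And>i. L2 N (l i)"
    and gram: "\<And>i j. (\<integral>x. k i x * k j x \<partial>M) = (\<integral>y. l i y * l j y \<partial>N)"
    and G: "L2 M G"
  obtains G' where "L2 N G'" "\<And>i. (\<integral>y. G' y * l i y \<partial>N) = (\<integral>x. G x * k i x \<partial>M)"
proof -
  define J where "J f = (\<integral>x. (G x - f x)\<^sup>2 \<partial>M)" for f
  define m where "m = Inf {J f |f f'. paired_span k l f f'}"
  have bdd: "bdd_below {J f |f f'. paired_span k l f f'}"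
    by (rule bdd_belowI[of _ 0]) (auto simp: J_def)
  have m_le: "m \<le> J f" if "paired_span k l f f'" for f f'
    unfolding m_def using that by (intro cInf_lower bdd) auto
  \<comment> \<open>The tolerance is chosen so that twice the sum of those at j and n, with n <= j,
    is at most (1/4)^n, the rate demanded by \<open>L2_complete_geometric\<close>.\<close>
  have "\<exists>f f'. paired_span k l f f' \<and> J f < m + (1/4)^n / 4" for n :: nat
  proof -
    have "m < m + (1/4)^n / 4" by simp
    moreover have "{J f |f f'. paired_span k l f f'} \<noteq> {}"
      using paired_span.base[of k l] by blast
    ultimately show ?thesis
      unfolding m_def using cInf_lessD by (smt (verit) mem_Collect_eq)
  qed
  then obtain s s' where s: "\<And>n. paired_span k l (s n) (s' n)"
    and Js: "\<And>n. J (s n) < m + (1/4)^n / 4"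
    by metis
  have s_L2: "L2 M (s n)" "L2 N (s' n)" for n
    using paired_span_L2[OF s k l] by auto

  have cauchy: "(\<integral>y. (s' j y - s' n y)\<^sup>2 \<partial>N) \<le> (1/4)^n" if "n \<le> j" for n j
  proof -
    have d: "paired_span k l (\<lambda>x. s j x - s n x) (\<lambda>x. s' j x - s' n x)"
      using paired_span.lincomb[OF s s, of 1 j "-1" n] by simp
    have mid: "paired_span k l (\<lambda>x. 1/2 * s j x + 1/2 * s n x) (\<lambda>x. 1/2 * s' j x + 1/2 * s' n x)"
      by (rule paired_span.lincomb[OF s s])
    have Gj: "L2 M (\<lambda>x. G x - s j x)" and Gn: "L2 M (\<lambda>x. G x - s n x)"
      using L2_diff[OF G s_L2(1)] by auto
    \<comment> \<open>Parallelogram law: near-minimisers of the distance to \<open>G\<close> are close to each other.\<close>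
    have "(\<integral>x. (s j x - s n x)\<^sup>2 \<partial>M) = 2 * J (s j) + 2 * J (s n) - 4 * J (\<lambda>x. 1/2 * s j x + 1/2 * s n x)"
      using L2_integral_square_lincomb[OF Gj Gn, of "-1" 1]
        L2_integral_square_lincomb[OF Gj Gn, of "1/2" "1/2"]
      by (simp add: J_def power2_eq_square algebra_simps)
    also have "\<dots> \<le> 2 * J (s j) + 2 * J (s n) - 4 * m"
      using m_le[OF mid] by simp
    also have "\<dots> \<le> (1/4)^j / 2 + (1/4)^n / 2"
      using Js[of j] Js[of n] by simp
    also have "\<dots> \<le> (1/4)^n"
      using power_decreasing[OF that, of "1/4::real"] by (simp del: power_decreasing_iff)
    \<comment> \<open>The isometry, applied to the difference paired with itself, moves the bound
      from \<open>M\<close> to \<open>N\<close>.\<close>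
    finally show ?thesis
      using paired_span_gram[OF k l gram d d] by (simp add: power2_eq_square)
  qed
  obtain G' where G': "L2 N G'" and lim: "\<And>n. (\<integral>y. (G' y - s' n y)\<^sup>2 \<partial>N) \<le> (1/4)^n"
    using L2_complete_geometric[OF s_L2(2) cauchy] by blast

  show thesis
  proof
    show "L2 N G'" by fact
    fix i
    let ?q = "\<integral>x. (k i x)\<^sup>2 \<partial>M" and ?r = "\<integral>y. (l i y)\<^sup>2 \<partial>N"
    have limI: "v \<longlonglongrightarrow> c" if "\<And>n. \<bar>c - v n\<bar> \<le> (1/2)^n * C" for v c and C :: real
    proof (rule LIM_zero_cancel, rule Lim_null_comparison)
      show "\<forall>\<^sub>F n in sequentially. norm (v n - c) \<le> (1/2)^n * C"
        using that by (simp add: abs_minus_commute)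
      show "(\<lambda>n. (1/2)^n * C) \<longlonglongrightarrow> 0"
        by (intro tendsto_mult_left_zero LIMSEQ_power_zero) simp
    qed
    have pow: "(1/4)^n = (1/2)^n * (1/2::real)^n" for n
      by (simp add: power_mult_distrib[symmetric])
    \<comment> \<open>Approximate orthogonality of the residual: moving \<open>s n\<close> by a
      multiple t of \<open>k i\<close> stays in the span and cannot bring the squared distance below
      \<open>m\<close>. The resulting quadratic inequality in t, taken at t = (1/2)^n and t =
      -(1/2)^n, balances the tolerance against the quadratic term.\<close>
    have "\<bar>\<integral>x. (G x - s n x) * k i x \<partial>M\<bar> \<le> (1/2)^n * (1 + ?q)" for n
    proof -
      let ?b = "\<integral>x. (G x - s n x) * k i x \<partial>M"
      have D: "L2 M (\<lambda>x. G x - s n x)"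
        using L2_diff[OF G s_L2(1)] .
      have *: "0 \<le> (1/4)^n / 4 - 2 * t * ?b + t\<^sup>2 * ?q" for t
      proof -
        have "m \<le> J (\<lambda>x. 1 * s n x + t * k i x)"
          using m_le[OF paired_span.lincomb[OF s paired_span.base]] .
        also have "\<dots> = J (s n) - 2 * t * ?b + t\<^sup>2 * ?q"
          using L2_integral_square_lincomb[OF D k, of 1 "-t" i] by (simp add: J_def algebra_simps)
        finally show ?thesis using Js[of n] by simp
      qed
      let ?t = "(1/2::real)^n"
      have "?t * (2 * \<bar>?b\<bar>) \<le> ?t * (?t / 4 + ?t * ?q)"
        using *[of ?t] *[of "-?t"] unfolding pow by (simp add: algebra_simps power2_eq_square abs_if)
      then have "2 * \<bar>?b\<bar> \<le> ?t / 4 + ?t * ?q"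
        by simp
      moreover have "0 \<le> ?t" "0 \<le> ?t * ?q" by simp_all
      ultimately show ?thesis unfolding distrib_left by linarith
    qed
    moreover have "(\<integral>x. (G x - s n x) * k i x \<partial>M) = (\<integral>x. G x * k i x \<partial>M) - (\<integral>x. s n x * k i x \<partial>M)" for n
      using L2_integral_lincomb_mult[OF G s_L2(1) k, of 1 "-1"] by simp
    ultimately have 1: "(\<lambda>n. \<integral>x. s n x * k i x \<partial>M) \<longlonglongrightarrow> (\<integral>x. G x * k i x \<partial>M)"
      by (intro limI[where C = "1 + ?q"]) simp
    \<comment> \<open>On the other side convergence in norm is available, so weighted Cauchy-Schwarz
      with t = (1/2)^n gives the same rate.\<close>
    have "\<bar>\<integral>y. (G' y - s' n y) * l i y \<partial>N\<bar> \<le> (1/2)^n * (1 + ?r)" for n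
    proof -
      let ?t = "(1/2::real)^n"
      have "2 * \<bar>\<integral>y. (G' y - s' n y) * l i y \<partial>N\<bar> \<le> (\<integral>y. (G' y - s' n y)\<^sup>2 \<partial>N) / ?t + ?t * ?r"
        using L2_abs_integral_mult_le[OF L2_diff[OF G' s_L2(2)] l] by simp
      also have "\<dots> \<le> (1/4)^n / ?t + ?t * ?r"
        by (intro add_right_mono divide_right_mono lim) simp
      also have "(1/4)^n / ?t = ?t"
        unfolding pow by simp
      finally have "2 * \<bar>\<integral>y. (G' y - s' n y) * l i y \<partial>N\<bar> \<le> ?t * (1 + ?r)"
        by (simp add: algebra_simps)
      then show ?thesis by linarith
    qed
    moreover have "(\<integral>y. (G' y - s' n y) * l i y \<partial>N) = (\<integral>y. G' y * l i y \<partial>N) - (\<integral>y. s' n y * l i y \<partial>N)" for n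
      using L2_integral_lincomb_mult[OF G' s_L2(2) l, of 1 "-1"] by simp
    ultimately have 2: "(\<lambda>n. \<integral>y. s' n y * l i y \<partial>N) \<longlonglongrightarrow> (\<integral>y. G' y * l i y \<partial>N)"
      by (intro limI[where C = "1 + ?r"]) simp
    have "(\<integral>x. s n x * k i x \<partial>M) = (\<integral>y. s' n y * l i y \<partial>N)" for n
      by (rule paired_span_gram[OF k l gram s paired_span.base])
    with 1 2 show "(\<integral>y. G' y * l i y \<partial>N) = (\<integral>x. G x * k i x \<partial>M)"
      by (simp add: LIMSEQ_unique)
  qed
qed

subsection \<open>Pseudoinverse\<close>

text \<open>Penrose's uniqueness argument, needed because \<open>pinv\<close> is a definite
  description. Transposing a product of two symmetric projections swaps its factors; this forces the
  projections \<open>A ** C\<close> and \<open>C ** A\<close> to coincide with those of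
  \<open>B\<close>, and then C = C A C = B A B = B.\<close>

lemma pinv_eqI:
  fixes A :: "real^'n^'m"
  assumes B: "A ** B ** A = A" "B ** A ** B = B"
    "transpose (A ** B) = A ** B" "transpose (B ** A) = B ** A"
  shows "pinv A = B"
  unfolding pinv_def
proof (rule the_equality)
  fix C assume C: "A ** C ** A = A \<and> C ** A ** C = C \<and>
      transpose (A ** C) = A ** C \<and> transpose (C ** A) = C ** A"
  have "A ** C = transpose ((A ** B ** A) ** C)"
    using B(1) C by simp
  also have "\<dots> = transpose ((A ** B) ** (A ** C))"
    by (simp add: matrix_mul_assoc)
  also have "\<dots> = (A ** C) ** (A ** B)"
    using B(3) C by (subst matrix_transpose_mul) simp
  also have "\<dots> = (A ** C ** A) ** B"
    by (simp add: matrix_mul_assoc)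
  finally have AC: "A ** C = A ** B"
    using C by simp
  have "C ** A = transpose (C ** (A ** B ** A))"
    using B(1) C by simp
  also have "\<dots> = transpose ((C ** A) ** (B ** A))"
    by (simp add: matrix_mul_assoc)
  also have "\<dots> = (B ** A) ** (C ** A)"
    using B(4) C by (subst matrix_transpose_mul) simp
  also have "\<dots> = B ** (A ** C ** A)"
    by (simp add: matrix_mul_assoc)
  finally have CA: "C ** A = B ** A"
    using C by simp
  have "C = C ** A ** C" using C by simp
  also have "\<dots> = B ** (A ** C)" by (simp add: CA matrix_mul_assoc)
  also have "\<dots> = B" using B(2) by (simp add: AC matrix_mul_assoc)
  finally show "C = B" .
qed (use B in simp)

text \<open>The candidate is a left inverse of \<open>V ** R\<close>, and the product in the other
  order is the symmetric matrix \<open>V ** transpose V\<close>; the Penrose equations follow. With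
  \<open>R\<close> the inverse of \<Sigma> this makes the pseudoinverse in the main result
  explicit.\<close>

lemma pinv_orthonormal_mult:
  fixes V :: "real^'d^'n" and T :: "real^'d^'d"
  assumes V: "transpose V ** V = mat 1" and T: "T ** R = mat 1" "R ** T = mat 1"
  shows "pinv (V ** R) = T ** transpose V"
proof -
  have "T ** transpose V ** (V ** R) = T ** (transpose V ** V) ** R"
    by (simp add: matrix_mul_assoc)
  then have l: "T ** transpose V ** (V ** R) = mat 1"
    using V T by simp
  have "V ** R ** (T ** transpose V) = V ** (R ** T) ** transpose V"
    by (simp add: matrix_mul_assoc)
  then have r: "V ** R ** (T ** transpose V) = V ** transpose V"
    using T by simp
  show ?thesis
  proof (rule pinv_eqI)
    show "V ** R ** (T ** transpose V) ** (V ** R) = V ** R"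
      using l by (metis matrix_mul_assoc matrix_mul_rid)
  qed (simp_all only: l r matrix_mul_lid transpose_mat matrix_transpose_mul transpose_transpose)
qed

lemma matrix_inv_diagonal:
  fixes T :: "real^'d^'d"
  assumes "\<forall>i j. i \<noteq> j \<longrightarrow> T $ i $ j = 0" "\<forall>i. T $ i $ i > 0"
  shows "T ** matrix_inv T = mat 1" "matrix_inv T ** T = mat 1"
proof -
  have "det T \<noteq> 0"
    using assms by (subst det_diagonal) (auto simp: less_le)
  then have "invertible T"
    by (simp add: invertible_det_nz)
  then have "\<exists>B. T ** B = mat 1 \<and> B ** T = mat 1"
    by (simp add: invertible_def)
  then have "T ** matrix_inv T = mat 1 \<and> matrix_inv T ** T = mat 1"
    unfolding matrix_inv_def by (rule someI_ex)
  then show "T ** matrix_inv T = mat 1" "matrix_inv T ** T = mat 1"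
    by auto
qed

subsection \<open>Gaussian densities\<close>

text \<open>The squared norm is a sum over coordinates, so the normalisation of the density reduces
  to that of the one-dimensional normal law.\<close>

lemma gauss_density_eq_prod:
  fixes y \<mu> :: "real^'m"
  assumes "\<sigma> > 0"
  shows "gauss_density \<sigma> \<mu> y = (\<Prod>b\<in>Basis. normal_density (\<mu> \<bullet> b) \<sigma> (y \<bullet> b))"
proof -
  have "(\<Prod>b\<in>(Basis::(real^'m) set). 1 / sqrt (2 * pi * \<sigma>\<^sup>2)) = (2 * pi * \<sigma>\<^sup>2) powr (- real CARD('m) / 2)"
  proof -
    have "(\<Prod>b\<in>(Basis::(real^'m) set). 1 / sqrt (2 * pi * \<sigma>\<^sup>2)) = ((2 * pi * \<sigma>\<^sup>2) powr (-1/2)) ^ CARD('m)"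
      using assms by (simp add: powr_minus_divide powr_half_sqrt)
    also have "\<dots> = (2 * pi * \<sigma>\<^sup>2) powr (real CARD('m) * (-1/2))"
      by (subst powr_realpow[symmetric]) (use assms in \<open>auto simp: powr_powr mult.commute\<close>)
    finally show ?thesis by simp
  qed
  moreover have "(norm (y - \<mu>))\<^sup>2 = (\<Sum>b\<in>Basis. (y \<bullet> b - \<mu> \<bullet> b)\<^sup>2)"
    unfolding norm_eq_sqrt_inner
    by (subst euclidean_inner) (simp add: sum_nonneg power2_eq_square inner_diff_left)
  then have "exp (- (norm (y - \<mu>))\<^sup>2 / (2 * \<sigma>\<^sup>2)) = (\<Prod>b\<in>Basis. exp (- (y \<bullet> b - \<mu> \<bullet> b)\<^sup>2 / (2 * \<sigma>\<^sup>2)))"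
    by (simp add: exp_sum[symmetric] sum_divide_distrib[symmetric] sum_negf)
  ultimately show ?thesis
    unfolding gauss_density_def normal_density_def prod.distrib by simp
qed

lemma gauss_density_pos: "\<sigma> > 0 \<Longrightarrow> gauss_density \<sigma> \<mu> y > 0"
  by (simp add: gauss_density_def)

lemma gauss_density_nonneg [simp]: "0 \<le> gauss_density \<sigma> \<mu> y"
  by (simp add: gauss_density_def)

lemma borel_measurable_gauss_density [measurable]: "gauss_density \<sigma> \<mu> \<in> borel_measurable borel"
  unfolding gauss_density_def by measurable

lemma has_bochner_integral_gauss_density:
  fixes \<mu> :: "real^'m"
  assumes "\<sigma> > 0"
  shows "has_bochner_integral lborel (gauss_density \<sigma> \<mu>) 1"
proof (rule has_bochner_integral_nn_integral)
  have "(\<integral>\<^sup>+y. ennreal (gauss_density \<sigma> \<mu> y) \<partial>lborel)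
      = (\<integral>\<^sup>+y. (\<Prod>b\<in>Basis. ennreal (normal_density (\<mu> \<bullet> b) \<sigma> (y \<bullet> b))) \<partial>lborel)"
    by (simp add: gauss_density_eq_prod[OF assms] prod_ennreal)
  also have "\<dots> = (\<Prod>b\<in>(Basis::(real^'m) set). \<integral>\<^sup>+t. ennreal (normal_density (\<mu> \<bullet> b) \<sigma> t) \<partial>lborel)"
    by (rule nn_integral_lborel_prod) auto
  also have "\<dots> = 1"
    using assms by (simp add: nn_integral_eq_integral)
  finally show "(\<integral>\<^sup>+y. ennreal (gauss_density \<sigma> \<mu> y) \<partial>lborel) = ennreal 1" by simp
qed auto

text \<open>Completing the square: the product of two likelihood ratios, weighted by the reference
  density, is a constant times a Gaussian with shifted mean. Its integral is therefore that
  constant.\<close>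

lemma gauss_density_ratio_mult:
  fixes \<mu> \<nu> \<kappa> :: "real^'m"
  assumes "\<sigma> > 0"
  shows "gauss_density \<sigma> \<kappa> y * (gauss_density \<sigma> \<mu> y / gauss_density \<sigma> \<kappa> y * (gauss_density \<sigma> \<nu> y / gauss_density \<sigma> \<kappa> y))
       = exp ((\<mu> - \<kappa>) \<bullet> (\<nu> - \<kappa>) / \<sigma>\<^sup>2) * gauss_density \<sigma> (\<mu> + \<nu> - \<kappa>) y"
proof -
  define A where "A = (2 * pi * \<sigma>\<^sup>2) powr (- real CARD('m) / 2)"
  have "A > 0" using assms by (simp add: A_def)
  have e: "- (norm (y - \<mu>))\<^sup>2 / (2 * \<sigma>\<^sup>2) + - (norm (y - \<nu>))\<^sup>2 / (2 * \<sigma>\<^sup>2)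
      = (\<mu> - \<kappa>) \<bullet> (\<nu> - \<kappa>) / \<sigma>\<^sup>2 + - (norm (y - (\<mu> + \<nu> - \<kappa>)))\<^sup>2 / (2 * \<sigma>\<^sup>2) + - (norm (y - \<kappa>))\<^sup>2 / (2 * \<sigma>\<^sup>2)"
    using assms
    by (simp add: power2_norm_eq_inner inner_diff_left inner_diff_right inner_add_left inner_add_right
        inner_commute field_simps)
  have "gauss_density \<sigma> \<mu> y * gauss_density \<sigma> \<nu> y
      = exp ((\<mu> - \<kappa>) \<bullet> (\<nu> - \<kappa>) / \<sigma>\<^sup>2) * gauss_density \<sigma> (\<mu> + \<nu> - \<kappa>) y * gauss_density \<sigma> \<kappa> y"
    using arg_cong[OF e, of exp] unfolding gauss_density_def A_def[symmetric] exp_add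
    by (simp add: mult_ac)
  then show ?thesis
    using gauss_density_pos[OF assms, of \<kappa> y] by (simp add: field_simps)
qed

subsection \<open>The exponential kernel on square-summable sequences\<close>

text \<open>For real families unconditional and absolute summability agree. This lets
  \<open>ell2\<close> be read as \<open>L2\<close> of the counting measure.\<close>

lemma integrable_count_space_iff_summable_on:
  "integrable (count_space UNIV) f \<longleftrightarrow> f summable_on UNIV" for f :: "'a \<Rightarrow> real"
  using abs_summable_equivalent[of f UNIV] summable_on_iff_abs_summable_on_real[of f UNIV]
  by (simp add: abs_summable_on_def)

lemma ell2_iff_L2: "ell2 a \<longleftrightarrow> L2 (count_space UNIV) a"
  by (simp add: ell2_def L2_def integrable_count_space_iff_summable_on)

lemma integral_count_space_eq_infsum:
  fixes f :: "'a \<Rightarrow> real"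
  assumes "integrable (count_space UNIV) f"
  shows "(\<integral>p. f p \<partial>count_space UNIV) = (\<Sum>\<^sub>\<infinity>p. f p)"
  using infsetsum_infsum[of f UNIV] assms by (simp add: abs_summable_on_def infsetsum_def)

text \<open>The normalised monomials of the Fock (Segal-Bargmann) space: the square root of the
  factorial enters each of two factors once, so their product is a term of an exponential
  series.\<close>

definition fock_feature :: "real^'d \<Rightarrow> ('d::finite \<Rightarrow> nat) \<Rightarrow> real" where
  "fock_feature z p = mpow z p / sqrt (mfact p)"

lemma fock_feature_mult:
  "fock_feature z p * fock_feature w p = (\<Prod>l\<in>UNIV. (z $ l * w $ l) ^ p l / fact (p l))"
proof -
  have "mfact p > 0" unfolding mfact_def by (intro prod_pos) auto
  then show ?thesis
    by (simp add: fock_feature_def mpow_def power_mult_distrib prod.distrib prod_dividef mfact_def)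
qed

lemma
  fixes z w :: "real^'d"
  shows integrable_fock_feature_mult:
      "integrable (count_space UNIV) (\<lambda>p. fock_feature z p * fock_feature w p)"
    and integral_fock_feature_mult:
      "(\<integral>p. fock_feature z p * fock_feature w p \<partial>count_space UNIV) = exp (z \<bullet> w)"
proof -
  \<comment> \<open>Multi-indices are written as a dependent product so that the sum over them
    factors into one exponential series per coordinate.\<close>
  have U: "(UNIV :: ('d \<Rightarrow> nat) set) = PiE UNIV (\<lambda>_. UNIV)"
    by auto
  have s: "Infinite_Set_Sum.abs_summable_on (\<lambda>n. t ^ n / fact n) (UNIV :: nat set)" for t :: real
    using summable_exp[of "\<bar>t\<bar>"]
    by (simp add: abs_summable_on_nat_iff' abs_mult power_abs field_simps)
  have e: "infsetsum (\<lambda>n. t ^ n / fact n) (UNIV :: nat set) = exp t" for t :: real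
    using infsetsum_nat'[OF s] exp_converges[of t] by (simp add: sums_iff field_simps)
  show "integrable (count_space UNIV) (\<lambda>p. fock_feature z p * fock_feature w p)"
    unfolding fock_feature_mult abs_summable_on_def[symmetric] U
    by (rule abs_summable_on_prod_PiE) (auto intro: s)
  have "(\<integral>p. fock_feature z p * fock_feature w p \<partial>count_space UNIV)
      = infsetsum (\<lambda>p. \<Prod>l\<in>UNIV. (z $ l * w $ l) ^ p l / fact (p l)) (PiE UNIV (\<lambda>_. UNIV))"
    unfolding fock_feature_mult infsetsum_def U ..
  also have "\<dots> = (\<Prod>l\<in>UNIV. infsetsum (\<lambda>n. (z $ l * w $ l) ^ n / fact n) UNIV)"
    by (rule infsetsum_prod_PiE) (auto intro: s)
  also have "\<dots> = exp (z \<bullet> w)"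
    by (simp add: e exp_sum inner_vec_def)
  finally show "(\<integral>p. fock_feature z p * fock_feature w p \<partial>count_space UNIV) = exp (z \<bullet> w)" .
qed

lemma L2_fock_feature: "L2 (count_space UNIV) (fock_feature z)"
  using integrable_fock_feature_mult[of z z] by (simp add: L2_def power2_eq_square)

subsection \<open>Likelihood ratios and the characterization of valid bias functions\<close>

lemma sets_obs_measure [measurable_cong]: "sets (obs_measure H \<sigma> x) = sets borel"
  by (simp add: obs_measure_def)

lemma
  fixes f :: "real^'m \<Rightarrow> real"
  assumes f: "f \<in> borel_measurable borel"
  shows integrable_obs_measure_iff:
      "integrable (obs_measure H \<sigma> x) f \<longleftrightarrow> integrable lborel (\<lambda>y. gauss_density \<sigma> (H *v x) y * f y)"
    and integral_obs_measure:
      "(\<integral>y. f y \<partial>obs_measure H \<sigma> x) = (\<integral>y. gauss_density \<sigma> (H *v x) y * f y \<partial>lborel)"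
  unfolding obs_measure_def using f by (simp_all add: integrable_density integral_density)

definition likelihood_ratio :: "real^'n^'m \<Rightarrow> real \<Rightarrow> real^'n \<Rightarrow> real^'n \<Rightarrow> real^'m \<Rightarrow> real" where
  "likelihood_ratio H \<sigma> x0 x y = gauss_density \<sigma> (H *v x) y / gauss_density \<sigma> (H *v x0) y"

lemma borel_measurable_likelihood_ratio [measurable]: "likelihood_ratio H \<sigma> x0 x \<in> borel_measurable borel"
  unfolding likelihood_ratio_def by measurable

text \<open>The density at \<open>x0\<close> is strictly positive, so every other law has a density
  with respect to it. Expectations under all \<open>x\<close> thereby become inner products under
  the single law at \<open>x0\<close>.\<close>

lemma
  fixes f :: "real^'m \<Rightarrow> real"
  assumes "\<sigma> > 0" and f: "f \<in> borel_measurable borel"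
  shows integrable_obs_measure_change:
      "integrable (obs_measure H \<sigma> x) f
        \<longleftrightarrow> integrable (obs_measure H \<sigma> x0) (\<lambda>y. f y * likelihood_ratio H \<sigma> x0 x y)"
    and integral_obs_measure_change:
      "(\<integral>y. f y \<partial>obs_measure H \<sigma> x) = (\<integral>y. f y * likelihood_ratio H \<sigma> x0 x y \<partial>obs_measure H \<sigma> x0)"
proof -
  have eq: "gauss_density \<sigma> (H *v x0) y * (f y * likelihood_ratio H \<sigma> x0 x y) = gauss_density \<sigma> (H *v x) y * f y" for y
    using gauss_density_pos[OF \<open>\<sigma> > 0\<close>, of "H *v x0" y] by (simp add: likelihood_ratio_def)
  show "integrable (obs_measure H \<sigma> x) f
        \<longleftrightarrow> integrable (obs_measure H \<sigma> x0) (\<lambda>y. f y * likelihood_ratio H \<sigma> x0 x y)"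
    "(\<integral>y. f y \<partial>obs_measure H \<sigma> x) = (\<integral>y. f y * likelihood_ratio H \<sigma> x0 x y \<partial>obs_measure H \<sigma> x0)"
    by (simp_all only: integrable_obs_measure_iff integral_obs_measure f eq
        borel_measurable_times borel_measurable_likelihood_ratio)
qed

lemma
  assumes "\<sigma> > 0"
  shows integrable_likelihood_ratio_mult:
      "integrable (obs_measure H \<sigma> x0) (\<lambda>y. likelihood_ratio H \<sigma> x0 x y * likelihood_ratio H \<sigma> x0 x' y)"
    and integral_likelihood_ratio_mult:
      "(\<integral>y. likelihood_ratio H \<sigma> x0 x y * likelihood_ratio H \<sigma> x0 x' y \<partial>obs_measure H \<sigma> x0)
        = exp ((H *v x - H *v x0) \<bullet> (H *v x' - H *v x0) / \<sigma>\<^sup>2)"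
proof -
  have "has_bochner_integral lborel
     (\<lambda>y. exp ((H *v x - H *v x0) \<bullet> (H *v x' - H *v x0) / \<sigma>\<^sup>2) * gauss_density \<sigma> (H *v x + H *v x' - H *v x0) y)
     (exp ((H *v x - H *v x0) \<bullet> (H *v x' - H *v x0) / \<sigma>\<^sup>2) * 1)"
    by (intro has_bochner_integral_mult_right has_bochner_integral_gauss_density assms)
  then have "has_bochner_integral lborel
      (\<lambda>y. gauss_density \<sigma> (H *v x0) y * (likelihood_ratio H \<sigma> x0 x y * likelihood_ratio H \<sigma> x0 x' y))
      (exp ((H *v x - H *v x0) \<bullet> (H *v x' - H *v x0) / \<sigma>\<^sup>2))"
    by (simp only: likelihood_ratio_def gauss_density_ratio_mult[OF assms] mult_1_right)
  then show "integrable (obs_measure H \<sigma> x0) (\<lambda>y. likelihood_ratio H \<sigma> x0 x y * likelihood_ratio H \<sigma> x0 x' y)"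
    "(\<integral>y. likelihood_ratio H \<sigma> x0 x y * likelihood_ratio H \<sigma> x0 x' y \<partial>obs_measure H \<sigma> x0)
        = exp ((H *v x - H *v x0) \<bullet> (H *v x' - H *v x0) / \<sigma>\<^sup>2)"
    by (simp_all add: integrable_obs_measure_iff integral_obs_measure has_bochner_integral_iff)
qed

lemma L2_likelihood_ratio:
  assumes "\<sigma> > 0"
  shows "L2 (obs_measure H \<sigma> x0) (likelihood_ratio H \<sigma> x0 x)"
  using integrable_likelihood_ratio_mult[OF assms, of H x0 x x] by (simp add: L2_def power2_eq_square)

text \<open>The constant 1 is the likelihood ratio of \<open>x\<close> against itself.\<close>

lemma L2_const_obs_measure:
  assumes "\<sigma> > 0"
  shows "L2 (obs_measure H \<sigma> x) (\<lambda>_. c)"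
proof -
  have "likelihood_ratio H \<sigma> x x = (\<lambda>_. 1)"
    using gauss_density_pos[OF assms, of "H *v x"]
    by (simp add: likelihood_ratio_def fun_eq_iff less_imp_neq[THEN not_sym])
  then show ?thesis
    using L2_lincomb[OF L2_likelihood_ratio[OF assms, of H x x] L2_likelihood_ratio[OF assms, of H x x], of c 0]
    by simp
qed

text \<open>The variance is the squared norm after subtracting a constant, and constants are in
  \<open>L2\<close>. This puts the estimators in the scope of the transfer theorem.\<close>

lemma finite_variance_iff_L2:
  assumes "\<sigma> > 0"
  shows "integrable (obs_measure H \<sigma> x) gh \<and> variance_at H \<sigma> gh x < \<infinity> \<longleftrightarrow> L2 (obs_measure H \<sigma> x) gh"
    (is "?fin \<longleftrightarrow> _")
proof
  let ?m = "expect H \<sigma> x gh" and ?P = "obs_measure H \<sigma> x"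
  note const = L2_const_obs_measure[OF assms, of H x]
  show "L2 ?P gh" if ?fin
  proof -
    have [measurable]: "gh \<in> borel_measurable ?P" using that by auto
    have "L2 ?P (\<lambda>y. gh y - ?m)"
      using that by (auto simp: L2_def variance_at_def intro!: integrableI_bounded)
    from L2_lincomb[OF this const, of 1 1 ?m] show ?thesis by simp
  qed
  show ?fin if "L2 ?P gh"
  proof
    show "integrable ?P gh"
      using L2_integrable_mult[OF that const[of 1]] by simp
    show "variance_at H \<sigma> gh x < \<infinity>"
      using L2_integrable_square[OF L2_diff[OF that const[of ?m]]]
      by (simp add: variance_at_def nn_integral_eq_integral)
  qed
qed

lemma orthonormal_inner_mult:
  fixes U :: "real^'d^'m"
  assumes "transpose U ** U = mat 1"
  shows "(U *v a) \<bullet> (U *v b) = a \<bullet> b"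
  by (metis assms dot_lmul_matrix matrix_vector_mul_assoc matrix_vector_mul_lid
      transpose_matrix_vector inner_commute)

theorem theorem4:
  fixes H :: "real^'n^'m" and S :: nat and \<sigma> :: real
    and g c :: "real^'n \<Rightarrow> real" and x0 :: "real^'n"
    and U :: "real^'d^'m" and \<Sigma> :: "real^'d^'d" and V :: "real^'d^'n"
  assumes S_range: "1 \<le> S" "S \<le> CARD('n)"
    and spark: "spark H > enat S"
    and sigma_pos: "\<sigma> > 0"
    and x0: "x0 \<in> sparse_set S"
    and D: "CARD('d) = rank H"
    and U_orth: "transpose U ** U = mat 1"
    and V_orth: "transpose V ** V = mat 1"
    and Sigma_diag: "\<forall>i j. i \<noteq> j \<longrightarrow> \<Sigma> $ i $ j = 0"
    and Sigma_pos: "\<forall>i. \<Sigma> $ i $ i > 0"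
    and svd: "H = U ** \<Sigma> ** transpose V"
  shows "valid_bias H \<sigma> S g c x0 \<longleftrightarrow>
    (\<exists>a :: ('d \<Rightarrow> nat) \<Rightarrow> real. ell2 a \<and>
      (\<forall>x\<in>sparse_set S.
         c x = exp ((norm (H *v x0))\<^sup>2 / (2 * \<sigma>\<^sup>2)
                    - (x \<bullet> (transpose H *v (H *v x0))) / \<sigma>\<^sup>2)
               * (\<Sum>\<^sub>\<infinity>p. a p / sqrt (mfact p)
                    * mpow ((1 / \<sigma>) *\<^sub>R (pinv (V ** matrix_inv \<Sigma>) *v x)) p)
             - g x))"
proof -
  let ?P = "obs_measure H \<sigma> x0" and ?L = "likelihood_ratio H \<sigma> x0"
  define z where "z x = (1 / \<sigma>) *\<^sub>R (pinv (V ** matrix_inv \<Sigma>) *v x)" for x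
  define E where "E x = exp ((norm (H *v x0))\<^sup>2 / (2 * \<sigma>\<^sup>2) - (x \<bullet> (transpose H *v (H *v x0))) / \<sigma>\<^sup>2)" for x
  define k where "k x y = ?L x y / E x" for x y
  have E_pos: "E x > 0" for x by (simp add: E_def)

  have "pinv (V ** matrix_inv \<Sigma>) = \<Sigma> ** transpose V"
    using pinv_orthonormal_mult[OF V_orth] matrix_inv_diagonal[OF Sigma_diag Sigma_pos] by blast
  then have Hz: "H *v x = \<sigma> *\<^sub>R (U *v z x)" for x
    using sigma_pos
    by (simp add: z_def svd matrix_vector_mul_assoc[symmetric] matrix_vector_mult_scaleR)
  have inner_z: "(H *v x) \<bullet> (H *v x') / \<sigma>\<^sup>2 = z x \<bullet> z x'" for x x'
    using sigma_pos by (simp add: Hz orthonormal_inner_mult[OF U_orth] power2_eq_square)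
  have E_eq: "E x = exp (z x0 \<bullet> z x0 / 2 - z x \<bullet> z x0)" for x
  proof -
    have "x \<bullet> (transpose H *v (H *v x0)) = (H *v x) \<bullet> (H *v x0)"
      by (metis dot_lmul_matrix inner_commute transpose_matrix_vector)
    then show ?thesis
      using inner_z[of x0 x0] inner_z[of x x0]
      by (simp add: E_def power2_norm_eq_inner field_simps)
  qed

  have L2_k: "L2 ?P (k x)" for x
    using L2_lincomb[OF L2_likelihood_ratio[OF sigma_pos, of H x0 x]
        L2_likelihood_ratio[OF sigma_pos, of H x0 x], of "1 / E x" 0] by (simp add: k_def[abs_def])
  have gram: "(\<integral>y. k x y * k x' y \<partial>?P)
      = (\<integral>p. fock_feature (z x) p * fock_feature (z x') p \<partial>count_space UNIV)" for x x'
  proof -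
    have "(\<integral>y. k x y * k x' y \<partial>?P) = (\<integral>y. ?L x y * ?L x' y \<partial>?P) / (E x * E x')"
      by (simp add: k_def)
    also have "\<dots> = exp ((z x - z x0) \<bullet> (z x' - z x0)) / (E x * E x')"
      \<comment> \<open>Both \<open>z\<close> and \<open>H\<close> act linearly, so the inner
        product identity applies to differences from \<open>x0\<close>.\<close>
      using inner_z[of "x - x0" "x' - x0"]
      by (simp add: integral_likelihood_ratio_mult[OF sigma_pos] matrix_vector_mult_diff_distrib z_def
          scaleR_diff_right)
    \<comment> \<open>The two prefactors each contribute half of \<open>z x0 \<bullet> z x0\<close>
      and one cross term, which cancels everything in the expanded exponent that involves
      \<open>x0\<close>.\<close>
    also have "\<dots> = exp (z x \<bullet> z x')"
      unfolding E_eq mult_exp_exp exp_diff[symmetric]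
      by (simp add: inner_diff_left inner_diff_right inner_commute)
    finally show ?thesis by (simp add: integral_fock_feature_mult)
  qed

  have expect_eq: "expect H \<sigma> x gh = E x * (\<integral>y. gh y * k x y \<partial>?P)" if "L2 ?P gh" for x gh
  proof -
    have "gh \<in> borel_measurable borel"
      using L2_measurable[OF that] by simp
    from integral_obs_measure_change[OF sigma_pos this, of H x x0] show ?thesis
      using E_pos[of x] by (simp add: expect_def k_def)
  qed
  \<comment> \<open>Square integrability at \<open>x0\<close> forces integrability under every
    \<open>x\<close>, because the likelihood ratio is itself square integrable; this supplies the
    integrability clauses of \<open>valid_bias\<close>.\<close>
  have integrable_gh: "integrable (obs_measure H \<sigma> x) gh" if "L2 ?P gh" for x gh
  proof -
    have "gh \<in> borel_measurable borel"
      using L2_measurable[OF that] by simp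
    from integrable_obs_measure_change[OF sigma_pos this] show ?thesis
      using L2_integrable_mult[OF that L2_likelihood_ratio[OF sigma_pos]] by blast
  qed
  have valid: "valid_bias H \<sigma> S g c x0 \<longleftrightarrow>
      (\<exists>gh. L2 ?P gh \<and> (\<forall>x\<in>sparse_set S. c x = E x * (\<integral>y. gh y * k x y \<partial>?P) - g x))"
    unfolding valid_bias_def conj_assoc[symmetric] finite_variance_iff_L2[OF sigma_pos]
    by (auto simp: bias_def expect_eq integrable_gh)

  have sum_eq: "(\<Sum>\<^sub>\<infinity>p. a p / sqrt (mfact p) * mpow (z x) p)
      = (\<integral>p. a p * fock_feature (z x) p \<partial>count_space UNIV)" if "ell2 a" for a x
    using integral_count_space_eq_infsum[OF L2_integrable_mult[OF that[unfolded ell2_iff_L2] L2_fock_feature[of "z x"]]]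
    by (simp add: fock_feature_def)

  show ?thesis
    unfolding valid z_def[symmetric] E_def[symmetric]
  proof
    assume "\<exists>gh. L2 ?P gh \<and> (\<forall>x\<in>sparse_set S. c x = E x * (\<integral>y. gh y * k x y \<partial>?P) - g x)"
    then obtain gh where gh: "L2 ?P gh"
      and c: "\<And>x. x \<in> sparse_set S \<Longrightarrow> c x = E x * (\<integral>y. gh y * k x y \<partial>?P) - g x" by blast
    \<comment> \<open>The transferred identity holds for every \<open>x\<close> and is then
      specialised to sparse \<open>x\<close>, where \<open>c\<close> is described.\<close>
    obtain a where "L2 (count_space UNIV) a"
      "\<And>x. (\<integral>p. a p * fock_feature (z x) p \<partial>count_space UNIV) = (\<integral>y. gh y * k x y \<partial>?P)"
      by (rule equal_gram_transfer[where l = "\<lambda>x. fock_feature (z x)", OF L2_k L2_fock_feature gram gh]) (rule that)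
    then show "\<exists>a. ell2 a \<and> (\<forall>x\<in>sparse_set S.
        c x = E x * (\<Sum>\<^sub>\<infinity>p. a p / sqrt (mfact p) * mpow (z x) p) - g x)"
      using c sum_eq[of a] by (intro exI[of _ a]) (simp add: ell2_iff_L2)
  next
    assume "\<exists>a. ell2 a \<and> (\<forall>x\<in>sparse_set S.
        c x = E x * (\<Sum>\<^sub>\<infinity>p. a p / sqrt (mfact p) * mpow (z x) p) - g x)"
    then obtain a where a: "ell2 a"
      and c: "\<And>x. x \<in> sparse_set S \<Longrightarrow>
        c x = E x * (\<Sum>\<^sub>\<infinity>p. a p / sqrt (mfact p) * mpow (z x) p) - g x" by blast
    \<comment> \<open>The same transfer with the families exchanged: the coefficient sequence now
      plays the part of \<open>G\<close>, and the resulting function of the observation is the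
      estimator.\<close>
    obtain gh where "L2 ?P gh"
      "\<And>x. (\<integral>y. gh y * k x y \<partial>?P) = (\<integral>p. a p * fock_feature (z x) p \<partial>count_space UNIV)"
      by (rule equal_gram_transfer[where k = "\<lambda>x. fock_feature (z x)",
            OF L2_fock_feature L2_k gram[symmetric] a[unfolded ell2_iff_L2]]) (rule that)
    then show "\<exists>gh. L2 ?P gh \<and> (\<forall>x\<in>sparse_set S. c x = E x * (\<integral>y. gh y * k x y \<partial>?P) - g x)"
      using c sum_eq[OF a] by (intro exI[of _ gh]) simp
  qed
qed

end
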